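(* Let $a<b$ be real, $n\ge1$ an integer, $h=(b-a)/(2n)$, and $x_i=a+ih$ for $i=0,1,\dots,2n$. Let $k\in\{2,3,4,5,6\}$ and let $f\in C^k([a,b])$ be real-valued; write $f_i=f(x_i)$. Then $$\int_a^bf(x)\,dx=\frac h{15}\sum_{j=1,\,j\text{ odd}}^{2n-1}\left[7f_{j-1}+16f_j+7f_{j+1}\right]-\frac{h^2}{15}\left[f'(b)-f'(a)\right]+\bar R_k(f),$$ where $$\bar R_k(f)=\sum_{j=1,\,j\text{ odd}}^{2n-1}\int_{x_{j-1}}^{x_{j+1}}\bar T_{kj}(x)f^{(k)}(x)\,dx .$$
   Context: For odd $j\in\{1,3,\dots,2n-1\}$ the kernel $\bar T_{kj}$ on $[x_{j-1},x_{j+1}]$ is $\bar T_{kj}(x)=(-1)^k(2h)^kP_k\left(\frac{x-x_{j-1}}{2h}\right)$ for $x\in[x_{j-1},x_j]$ and $\bar T_{kj}(x)=(-1)^k(2h)^kQ_k\left(\frac{x-x_{j-1}}{2h}\right)$ for $x\in(x_j,x_{j+1}]$, where $P_2(x)=\frac12x^2-\frac7{30}x+\frac1{60}$, $Q_2(x)=\frac12x^2-\frac{23}{30}x+\frac{17}{60}$; $P_3(x)=\frac1{3!}x(x-\frac15)(x-\frac12)$, $Q_3(x)=\frac1{3!}(x-1)(x-\frac12)(x-\frac45)$; $P_4(x)=\frac1{4!}x^2(x-\frac13)(x-\frac35)$, $Q_4(x)=\frac1{4!}(x-1)^2(x-\frac23)(x-\frac25)$; $P_5(x)=\frac1{5!}x^3(x-\frac12)(x-\frac23)$,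 $Q_5(x)=\frac1{5!}(x-1)^3(x-\frac12)(x-\frac13)$; $P_6(x)=\frac1{6!}x^4(x^2-\frac75x+\frac12)$, $Q_6(x)=\frac1{6!}(x-1)^4(x^2-\frac35x+\frac1{10})$. *)

theory Defs
  imports "HOL-Analysis.Analysis"
begin

text \<open>
  Derivatives on \<open>[a, b]\<close> are taken within the interval: two-sided in the interior,
  one-sided at the end points. The values are meaningful only at points of \<open>[a, b]\<close>.
\<close>

definition nderiv_on :: "real \<Rightarrow> real \<Rightarrow> nat \<Rightarrow> (real \<Rightarrow> real) \<Rightarrow> real \<Rightarrow> real" where
  "nderiv_on a b k f = ((\<lambda>g t. vector_derivative g (at t within {a..b})) ^^ k) f"

definition C_k_on :: "nat \<Rightarrow> (real \<Rightarrow> real) \<Rightarrow> real \<Rightarrow> real \<Rightarrow> bool" where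
  "C_k_on k f a b \<longleftrightarrow>
     (\<forall>i<k. nderiv_on a b i f differentiable_on {a..b}) \<and>
     continuous_on {a..b} (nderiv_on a b k f)"

text \<open>Only the indices 2 to 6 are used in the two families of kernel polynomials.\<close>

definition kerP :: "nat \<Rightarrow> real \<Rightarrow> real" where
  "kerP k t =
    (if k = 2 then 1/2 * t^2 - 7/30 * t + 1/60
     else if k = 3 then 1 / fact 3 * t * (t - 1/5) * (t - 1/2)
     else if k = 4 then 1 / fact 4 * t^2 * (t - 1/3) * (t - 3/5)
     else if k = 5 then 1 / fact 5 * t^3 * (t - 1/2) * (t - 2/3)
     else if k = 6 then 1 / fact 6 * t^4 * (t^2 - 7/5 * t + 1/2)
     else undefined)"

definition kerQ :: "nat \<Rightarrow> real \<Rightarrow> real" where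
  "kerQ k t =
    (if k = 2 then 1/2 * t^2 - 23/30 * t + 17/60
     else if k = 3 then 1 / fact 3 * (t - 1) * (t - 1/2) * (t - 4/5)
     else if k = 4 then 1 / fact 4 * (t - 1)^2 * (t - 2/3) * (t - 2/5)
     else if k = 5 then 1 / fact 5 * (t - 1)^3 * (t - 1/2) * (t - 1/3)
     else if k = 6 then 1 / fact 6 * (t - 1)^4 * (t^2 - 3/5 * t + 1/10)
     else undefined)"

text \<open>
  The kernel for step \<open>h\<close> and nodes \<open>x\<close>, for odd \<open>j\<close>; it is used only for
  \<open>t\<close> in \<open>[x (j - 1), x (j + 1)]\<close>, so the second branch is \<open>(x j, x (j + 1)]\<close>.
\<close>

definition Tbar :: "real \<Rightarrow> (nat \<Rightarrow> real) \<Rightarrow> nat \<Rightarrow> nat \<Rightarrow> real \<Rightarrow> real" where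
  "Tbar h x k j t =
    (if t \<le> x j then (-1)^k * (2*h)^k * kerP k ((t - x (j - 1)) / (2*h))
     else (-1)^k * (2*h)^k * kerQ k ((t - x (j - 1)) / (2*h)))"

definition Rbar ::
    "real \<Rightarrow> real \<Rightarrow> nat \<Rightarrow> real \<Rightarrow> (nat \<Rightarrow> real) \<Rightarrow> nat \<Rightarrow> (real \<Rightarrow> real) \<Rightarrow> real" where
  "Rbar a b n h x k f =
    (\<Sum>j | j \<in> {1..2*n - 1} \<and> odd j.
       integral {x (j - 1)..x (j + 1)} (\<lambda>t. Tbar h x k j t * nderiv_on a b k f t))"

end

theory Submission
  imports Defs
begin

text \<open>
  The identity is integration by parts on each panel \<open>[x (j - 1), x (j + 1)]\<close>, rescaled to
  \<open>[0, 1]\<close>. The kernel polynomials form a chain \<open>P\<^sub>k\<^sub>+\<^sub>1' = P\<^sub>k\<close>, \<open>Q\<^sub>k\<^sub>+\<^sub>1' = Q\<^sub>k\<close>, whose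
  integration constants are fixed by what the boundary terms have to be. For \<open>k \<ge> 3\<close> the
  constants make \<open>P\<^sub>k\<close> vanish at 0, make \<open>Q\<^sub>k\<close> vanish at 1 and make both agree at \<open>1/2\<close>, so all
  boundary terms disappear and the remainder with kernel of index \<open>k\<close> equals the one with index
  \<open>k - 1\<close> (\<open>panel_remainder_Suc\<close>). Hence every remainder equals the one for \<open>k = 2\<close>.

  For \<open>k = 2\<close> two more integrations by parts (\<open>panel_remainder_2\<close>) lead to the integral of \<open>f\<close>.
  The first produces the end-point values \<open>P\<^sub>2 0 = Q\<^sub>2 1 = 1/60\<close>, hence the correction with \<open>f'\<close>; the
  second uses \<open>P\<^sub>1 s = s - 7/30\<close> and \<open>Q\<^sub>1 s = s - 23/30\<close>, whose end-point values and whose jump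
  \<open>16/30\<close> at the midpoint are the weights 7, 16, 7. In the sum over the panels the integrals of
  \<open>f\<close> add up and the terms with \<open>f'\<close> telescope.
\<close>

section \<open>Integration by parts on one panel\<close>

definition panel_kernel ::
    "real \<Rightarrow> real \<Rightarrow> (real \<Rightarrow> real) \<Rightarrow> (real \<Rightarrow> real) \<Rightarrow> real \<Rightarrow> real" where
  "panel_kernel c H P Q t = (if t \<le> c + H/2 then P ((t - c) / H) else Q ((t - c) / H))"

lemma panel_kernel_has_integral:
  assumes "H > 0"
    and "((\<lambda>t. P ((t - c) / H) * g t) has_integral I) {c..c + H/2}"
    and "((\<lambda>t. Q ((t - c) / H) * g t) has_integral J) {c + H/2..c + H}"
  shows "((\<lambda>t. panel_kernel c H P Q t * g t) has_integral (I + J)) {c..c + H}"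
proof (rule has_integral_combine)
  show "c \<le> c + H/2" "c + H/2 \<le> c + H"
    using assms(1) by auto
  show "((\<lambda>t. panel_kernel c H P Q t * g t) has_integral I) {c..c + H/2}"
    by (rule has_integral_eq[OF _ assms(2)]) (simp add: panel_kernel_def)
  show "((\<lambda>t. panel_kernel c H P Q t * g t) has_integral J) {c + H/2..c + H}"
    \<comment> \<open>The kernel takes its left value at the midpoint, a set of measure zero.\<close>
    by (rule has_integral_spike_finite[of "{c + H/2}", OF _ _ assms(3)])
       (auto simp: panel_kernel_def)
qed

lemma integral_by_parts_continuous:
  fixes p p' g g' :: "real \<Rightarrow> real"
  assumes "u \<le> v"
    and p: "\<And>t. t \<in> {u..v} \<Longrightarrow> (p has_vector_derivative p' t) (at t within {u..v})"
    and g: "\<And>t. t \<in> {u..v} \<Longrightarrow> (g has_vector_derivative g' t) (at t within {u..v})"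
    and "continuous_on {u..v} p'" "continuous_on {u..v} g'"
  shows "((\<lambda>t. p t * g' t) has_integral
          (p v * g v - p u * g u - integral {u..v} (\<lambda>t. p' t * g t))) {u..v}"
proof -
  have "continuous_on {u..v} g"
    using g by (meson continuous_on_vector_derivative)
  then have int: "(\<lambda>t. p' t * g t) integrable_on {u..v}"
    by (intro integrable_continuous_real continuous_intros assms)
  have "((\<lambda>t. p t * g' t + p' t * g t) has_integral (p v * g v - p u * g u)) {u..v}"
    using assms(1) p g by (intro fundamental_theorem_of_calculus has_vector_derivative_mult)
  from has_integral_diff[OF this integrable_integral[OF int]] show ?thesis
    by simp
qed

text \<open>
  The kernel may jump at the midpoint, which is why the value of \<open>g\<close> there enters with the jump as
  its weight.
\<close>

lemma panel_by_parts:
  fixes P P' Q Q' g g' :: "real \<Rightarrow> real"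
  assumes H: "H > 0"
    and P: "\<And>s. (P has_real_derivative P' s) (at s)" "continuous_on UNIV P'"
    and Q: "\<And>s. (Q has_real_derivative Q' s) (at s)" "continuous_on UNIV Q'"
    and g: "\<And>t. t \<in> {c..c + H} \<Longrightarrow> (g has_vector_derivative g' t) (at t within {c..c + H})"
    and g': "continuous_on {c..c + H} g'"
  shows "integral {c..c + H} (\<lambda>t. panel_kernel c H P Q t * g' t) =
           Q 1 * g (c + H) - P 0 * g c + (P (1/2) - Q (1/2)) * g (c + H/2)
           - integral {c..c + H} (\<lambda>t. panel_kernel c H P' Q' t * g t) / H"
proof -
  have scaled: "((\<lambda>t. R ((t - c) / H)) has_vector_derivative R' ((t - c) / H) / H) (at t within S)"
    if "\<And>s. (R has_real_derivative R' s) (at s)" for R R' :: "real \<Rightarrow> real" and t S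
  proof -
    have "((\<lambda>t. (t - c) / H) has_real_derivative 1 / H) (at t within S)"
      using H by (auto intro!: derivative_eq_intros)
    from DERIV_chain2[OF that this] show ?thesis
      by (simp add: has_real_derivative_iff_has_vector_derivative)
  qed
  have cont: "continuous_on S (\<lambda>t. R' ((t - c) / H))"
    if "continuous_on UNIV R'" for R' :: "real \<Rightarrow> real" and S
    by (rule continuous_on_compose2[OF that]) (use H in \<open>auto intro!: continuous_intros\<close>)
  have cg: "continuous_on {c..c + H} g"
    using g by (meson continuous_on_vector_derivative)
  have half: "((\<lambda>t. R ((t - c) / H) * g' t) has_integral
        (R ((v - c) / H) * g v - R ((u - c) / H) * g u
          - integral {u..v} (\<lambda>t. R' ((t - c) / H) * g t) / H)) {u..v}"
      and half': "(\<lambda>t. R' ((t - c) / H) * g t) integrable_on {u..v}"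
    if R: "\<And>s. (R has_real_derivative R' s) (at s)" "continuous_on UNIV R'"
      and uv: "u \<le> v" "{u..v} \<subseteq> {c..c + H}" for R R' :: "real \<Rightarrow> real" and u v
  proof -
    have "((\<lambda>t. R ((t - c) / H) * g' t) has_integral
        (R ((v - c) / H) * g v - R ((u - c) / H) * g u
          - integral {u..v} (\<lambda>t. R' ((t - c) / H) / H * g t))) {u..v}"
    proof (rule integral_by_parts_continuous[OF uv(1) scaled[OF R(1)]])
      show "(g has_vector_derivative g' t) (at t within {u..v})" if "t \<in> {u..v}" for t
        using g[of t] that uv(2) has_vector_derivative_within_subset by blast
      show "continuous_on {u..v} (\<lambda>t. R' ((t - c) / H) / H)"
        using H by (intro continuous_intros cont[OF R(2)]) auto
      show "continuous_on {u..v} g'"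
        using g' uv(2) continuous_on_subset by blast
    qed
    then show "((\<lambda>t. R ((t - c) / H) * g' t) has_integral
        (R ((v - c) / H) * g v - R ((u - c) / H) * g u
          - integral {u..v} (\<lambda>t. R' ((t - c) / H) * g t) / H)) {u..v}"
      by simp
    show "(\<lambda>t. R' ((t - c) / H) * g t) integrable_on {u..v}"
      using uv(2) cg by (intro integrable_continuous_real continuous_intros cont[OF R(2)])
        (rule continuous_on_subset)
  qed
  have left: "c \<le> c + H/2" "{c..c + H/2} \<subseteq> {c..c + H}"
    and right: "c + H/2 \<le> c + H" "{c + H/2..c + H} \<subseteq> {c..c + H}"
    using H by auto
  note lower = panel_kernel_has_integral[OF H
      integrable_integral[OF half'[OF P left]] integrable_integral[OF half'[OF Q right]]]
  note upper = panel_kernel_has_integral[OF H half[OF P left] half[OF Q right]]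
  show ?thesis
    unfolding integral_unique[OF lower] integral_unique[OF upper]
    using H by (simp add: field_simps)
qed

section \<open>The chain of kernel polynomials\<close>

lemma kerP_has_real_derivative:
  assumes "k \<in> {2, 3, 4, 5}"
  shows "(kerP (Suc k) has_real_derivative kerP k s) (at s)"
  using assms unfolding kerP_def[abs_def]
  by (elim insertE emptyE)
     (auto intro!: derivative_eq_intros simp: fact_numeral eval_nat_numeral field_simps)

lemma kerQ_has_real_derivative:
  assumes "k \<in> {2, 3, 4, 5}"
  shows "(kerQ (Suc k) has_real_derivative kerQ k s) (at s)"
  using assms unfolding kerQ_def[abs_def]
  by (elim insertE emptyE)
     (auto intro!: derivative_eq_intros simp: fact_numeral eval_nat_numeral field_simps)

lemma kerP_2_has_real_derivative: "(kerP 2 has_real_derivative (s - 7/30)) (at s)"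
  unfolding kerP_def[abs_def] by (auto intro!: derivative_eq_intros)

lemma kerQ_2_has_real_derivative: "(kerQ 2 has_real_derivative (s - 23/30)) (at s)"
  unfolding kerQ_def[abs_def] by (auto intro!: derivative_eq_intros)

lemma continuous_on_kerP: "k \<in> {2, 3, 4, 5, 6} \<Longrightarrow> continuous_on S (kerP k)"
  unfolding kerP_def[abs_def] by (auto intro!: continuous_intros)

lemma continuous_on_kerQ: "k \<in> {2, 3, 4, 5, 6} \<Longrightarrow> continuous_on S (kerQ k)"
  unfolding kerQ_def[abs_def] by (auto intro!: continuous_intros)

lemma kerP_0_eq_0: "k \<in> {3, 4, 5, 6} \<Longrightarrow> kerP k 0 = 0"
  by (auto simp: kerP_def)

lemma kerQ_1_eq_0: "k \<in> {3, 4, 5, 6} \<Longrightarrow> kerQ k 1 = 0"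
  by (auto simp: kerQ_def)

text \<open>
  The two branches are mirror images, \<open>Q\<^sub>k s = (-1)\<^sup>k P\<^sub>k (1 - s)\<close>. At the midpoint they agree for
  even \<open>k\<close> by this symmetry, and for odd \<open>k\<close> because both vanish.
\<close>

lemma kerP_half_eq_kerQ_half: "k \<in> {2, 3, 4, 5, 6} \<Longrightarrow> kerP k (1/2) = kerQ k (1/2)"
  by (auto simp: kerP_def kerQ_def fact_numeral eval_nat_numeral)

section \<open>The quadrature rule with remainder on one panel\<close>

lemma nderiv_on_has_vector_derivative:
  assumes "C_k_on k f a b" "i < k" "t \<in> {a..b}"
  shows "(nderiv_on a b i f has_vector_derivative nderiv_on a b (Suc i) f t) (at t within {a..b})"
proof -
  have "nderiv_on a b i f differentiable (at t within {a..b})"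
    using assms by (auto simp: C_k_on_def differentiable_on_def)
  then show ?thesis
    by (simp add: vector_derivative_works nderiv_on_def)
qed

lemma continuous_on_nderiv_on:
  assumes "C_k_on k f a b" "i \<le> k"
  shows "continuous_on {a..b} (nderiv_on a b i f)"
  using assms by (cases "i = k") (auto simp: C_k_on_def intro: differentiable_imp_continuous_on)

definition panel_remainder ::
    "real \<Rightarrow> real \<Rightarrow> real \<Rightarrow> real \<Rightarrow> nat \<Rightarrow> (real \<Rightarrow> real) \<Rightarrow> real" where
  "panel_remainder a b c H k f =
     (-H)^k * integral {c..c + H} (\<lambda>t. panel_kernel c H (kerP k) (kerQ k) t * nderiv_on a b k f t)"

lemma panel_by_parts_nderiv_on:
  assumes "C_k_on m f a b" "i < m" "H > 0" "{c..c + H} \<subseteq> {a..b}"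
    and "\<And>s. (P has_real_derivative P' s) (at s)" "continuous_on UNIV P'"
    and "\<And>s. (Q has_real_derivative Q' s) (at s)" "continuous_on UNIV Q'"
  shows "integral {c..c + H} (\<lambda>t. panel_kernel c H P Q t * nderiv_on a b (Suc i) f t) =
           Q 1 * nderiv_on a b i f (c + H) - P 0 * nderiv_on a b i f c
           + (P (1/2) - Q (1/2)) * nderiv_on a b i f (c + H/2)
           - integral {c..c + H} (\<lambda>t. panel_kernel c H P' Q' t * nderiv_on a b i f t) / H"
proof (rule panel_by_parts[OF assms(3,5-8)])
  show "(nderiv_on a b i f has_vector_derivative nderiv_on a b (Suc i) f t) (at t within {c..c + H})"
    if "t \<in> {c..c + H}" for t
    using nderiv_on_has_vector_derivative[OF assms(1,2), of t] that assms(4)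
      has_vector_derivative_within_subset by blast
  show "continuous_on {c..c + H} (nderiv_on a b (Suc i) f)"
    using continuous_on_nderiv_on[OF assms(1)] assms(2,4) continuous_on_subset Suc_leI by metis
qed

text \<open>
  Here no boundary terms survive, and the factor \<open>-1/H\<close> from the rescaled derivative is absorbed
  by the normalisation \<open>(-H)\<^sup>k\<close>.
\<close>

lemma panel_remainder_Suc:
  assumes "C_k_on m f a b" "k < m" "H > 0" "{c..c + H} \<subseteq> {a..b}" "k \<in> {2, 3, 4, 5}"
  shows "panel_remainder a b c H (Suc k) f = panel_remainder a b c H k f"
proof -
  have Suc_k: "Suc k \<in> {3, 4, 5, 6}" "Suc k \<in> {2, 3, 4, 5, 6}" and k: "k \<in> {2, 3, 4, 5, 6}"
    using assms(5) by auto
  show ?thesis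
    unfolding panel_remainder_def
      panel_by_parts_nderiv_on[OF assms(1-4)
        kerP_has_real_derivative[OF assms(5)] continuous_on_kerP[OF k]
        kerQ_has_real_derivative[OF assms(5)] continuous_on_kerQ[OF k]]
    using assms(3) by (simp add: kerP_0_eq_0[OF Suc_k(1)] kerQ_1_eq_0[OF Suc_k(1)]
        kerP_half_eq_kerQ_half[OF Suc_k(2)])
qed

lemma panel_remainder_eq_2:
  assumes "C_k_on k f a b" "H > 0" "{c..c + H} \<subseteq> {a..b}" "k \<in> {2, 3, 4, 5, 6}"
  shows "panel_remainder a b c H k f = panel_remainder a b c H 2 f"
proof -
  have "l \<le> k \<longrightarrow> panel_remainder a b c H l f = panel_remainder a b c H 2 f" if "2 \<le> l" for l
    using that
  proof (induction l rule: dec_induct)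
    case (step l)
    show ?case
    proof
      assume "Suc l \<le> k"
      then have l: "l \<le> k" "l < k" "l \<in> {2, 3, 4, 5}"
        using step.hyps assms(4) by auto
      have "panel_remainder a b c H (Suc l) f = panel_remainder a b c H l f"
        by (rule panel_remainder_Suc[OF assms(1) l(2) assms(2,3) l(3)])
      also have "\<dots> = panel_remainder a b c H 2 f"
        using step.IH l(1) by blast
      finally show "panel_remainder a b c H (Suc l) f = panel_remainder a b c H 2 f" .
    qed
  qed simp
  moreover have "2 \<le> k"
    using assms(4) by auto
  ultimately show ?thesis
    by blast
qed

text \<open>
  The weights 7, 16, 7 come from the second integration by parts: they are, over 30, the values
  \<open>Q\<^sub>1 1\<close>, \<open>P\<^sub>1 (1/2) - Q\<^sub>1 (1/2)\<close> and \<open>- P\<^sub>1 0\<close> of the derivatives \<open>P\<^sub>1\<close>, \<open>Q\<^sub>1\<close> of the kernels of index 2.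
\<close>

lemma panel_remainder_2:
  assumes "C_k_on m f a b" "2 \<le> m" "H > 0" "{c..c + H} \<subseteq> {a..b}"
  shows "integral {c..c + H} f =
           H / 30 * (7 * f c + 16 * f (c + H/2) + 7 * f (c + H))
           - H^2 / 60 * (nderiv_on a b 1 f (c + H) - nderiv_on a b 1 f c)
           + panel_remainder a b c H 2 f"
proof -
  let ?f' = "nderiv_on a b 1 f" and ?P1 = "\<lambda>s::real. s - 7/30" and ?Q1 = "\<lambda>s::real. s - 23/30"
  have f0: "nderiv_on a b 0 f = f"
    by (simp add: nderiv_on_def)
  have lt: "0 < m" "1 < m"
    using assms(2) by auto
  have one: "panel_kernel c H (\<lambda>s. 1) (\<lambda>s. 1) = (\<lambda>t. 1)"
    by (auto simp: panel_kernel_def)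
  have ends: "kerP 2 0 = 1/60" "kerQ 2 1 = 1/60" "kerP 2 (1/2) = kerQ 2 (1/2)"
    using kerP_half_eq_kerQ_half[of 2] by (auto simp: kerP_def kerQ_def)
  have deriv: "(?P1 has_real_derivative 1) (at s)" "(?Q1 has_real_derivative 1) (at s)" for s
    by (auto intro!: derivative_eq_intros)
  have cont: "continuous_on UNIV ?P1" "continuous_on UNIV ?Q1"
    by (auto intro!: continuous_intros)
  have step_1: "integral {c..c + H} (\<lambda>t. panel_kernel c H ?P1 ?Q1 t * ?f' t) =
      7/30 * f (c + H) + 7/30 * f c + 16/30 * f (c + H/2) - integral {c..c + H} f / H"
    using panel_by_parts_nderiv_on[OF assms(1) lt(1) assms(3,4)
        deriv(1) continuous_on_const deriv(2) continuous_on_const]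
    by (simp add: f0 one)
  have step_2: "integral {c..c + H}
        (\<lambda>t. panel_kernel c H (kerP 2) (kerQ 2) t * nderiv_on a b 2 f t) =
      1/60 * (?f' (c + H) - ?f' c)
      - integral {c..c + H} (\<lambda>t. panel_kernel c H ?P1 ?Q1 t * ?f' t) / H"
    using panel_by_parts_nderiv_on[OF assms(1) lt(2) assms(3,4)
        kerP_2_has_real_derivative cont(1) kerQ_2_has_real_derivative cont(2), unfolded Suc_1]
    by (simp only: ends) (simp add: right_diff_distrib)
  show ?thesis
    unfolding panel_remainder_def step_2 step_1
    using assms(3) by (simp add: field_simps power2_eq_square)
qed

section \<open>Summation over the panels\<close>

lemma sum_odd_eq_sum_lessThan:
  fixes n :: nat
  shows "(\<Sum>j | j \<in> {1..2*n - 1} \<and> odd j. F j) = (\<Sum>i<n. F (2*i + 1))"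
proof (rule sum.reindex_bij_witness[of _ "\<lambda>i. 2*i + 1" "\<lambda>j. j div 2"])
  fix j assume j: "j \<in> {j. j \<in> {1..2*n - 1} \<and> odd j}"
  then have "odd j"
    by blast
  then show j_eq: "2 * (j div 2) + 1 = j"
    by (rule odd_two_times_div_two_succ)
  show "F (2 * (j div 2) + 1) = F j"
    unfolding j_eq ..
  from j have "j \<ge> 1" "j \<le> 2*n - 1"
    by simp_all
  then show "j div 2 \<in> {..<n}"
    unfolding lessThan_iff by linarith
next
  fix i assume "i \<in> {..<n}"
  then have "i < n"
    by simp
  then have "2*i + 1 \<le> 2*n - 1"
    by linarith
  then show "2*i + 1 \<in> {j. j \<in> {1..2*n - 1} \<and> odd j}"
    by simp
qed simp

lemma integral_eq_sum_integral_partition: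
  fixes y :: "nat \<Rightarrow> real" and f :: "real \<Rightarrow> real"
  assumes "incseq y" and "f integrable_on {y 0..y n}"
  shows "integral {y 0..y n} f = (\<Sum>i<n. integral {y i..y (Suc i)} f)"
  using assms(2)
proof (induction n)
  case (Suc n)
  have le: "y 0 \<le> y n" "y n \<le> y (Suc n)"
    using assms(1) by (simp_all add: incseqD)
  then have "f integrable_on {y 0..y n}"
    by (intro integrable_subinterval_real[OF Suc.prems]) auto
  from Suc.IH[OF this] show ?case
    using Henstock_Kurzweil_Integration.integral_combine[OF le Suc.prems] by simp
qed simp

theorem theorem7:
  fixes a b h :: real and n k :: nat and x :: "nat \<Rightarrow> real" and f :: "real \<Rightarrow> real"
  assumes "a < b" and "n \<ge> 1"
    and "h = (b - a) / (2 * real n)"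
    and "\<And>i. i \<le> 2*n \<Longrightarrow> x i = a + real i * h"
    and "k \<in> {2, 3, 4, 5, 6}"
    and "C_k_on k f a b"
  shows "integral {a..b} f =
           h / 15 * (\<Sum>j | j \<in> {1..2*n - 1} \<and> odd j.
                        7 * f (x (j - 1)) + 16 * f (x j) + 7 * f (x (j + 1)))
           - h^2 / 15 * (nderiv_on a b 1 f b - nderiv_on a b 1 f a)
           + Rbar a b n h x k f"
proof -
  define y where "y i = a + real i * (2*h)" for i
  let ?f' = "nderiv_on a b 1 f"
  have h: "h > 0"
    using assms(1-3) by simp
  have y0: "y 0 = a" and yn: "y n = b"
    using assms(2,3) by (auto simp: y_def field_simps)
  have y_Suc: "y (Suc i) = y i + 2*h" for i
    by (simp add: y_def algebra_simps)
  have nodes: "x (2*i) = y i" "x (2*i + 1) = y i + h" "x (2*i + 2) = y i + 2*h" if "i < n" for i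
    using that assms(4)[of "2*i"] assms(4)[of "2*i + 1"] assms(4)[of "2*i + 2"]
    by (auto simp: y_def algebra_simps)
  have sub: "{y i..y i + 2*h} \<subseteq> {a..b}" if "i < n" for i
  proof -
    have "real (Suc i) * (2*h) \<le> real n * (2*h)"
      using that h by (intro mult_right_mono) auto
    then have "y (Suc i) \<le> y n"
      unfolding y_def by simp
    moreover have "a \<le> y i"
      using h by (simp add: y_def)
    ultimately show ?thesis
      by (auto simp: y_Suc yn)
  qed
  have k2: "2 \<le> k"
    using assms(5) by auto
  have "f integrable_on {y 0..y n}"
    using continuous_on_nderiv_on[OF assms(6), of 0]
    by (auto simp: y0 yn nderiv_on_def intro: integrable_continuous_real)
  then have split: "integral {a..b} f = (\<Sum>i<n. integral {y i..y i + 2*h} f)"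
    using integral_eq_sum_integral_partition[of y f n] h
    by (simp add: y0 yn y_Suc incseq_Suc_iff)
  have panel: "integral {y i..y i + 2*h} f =
      h / 15 * (7 * f (y i) + 16 * f (y i + h) + 7 * f (y i + 2*h))
      - h^2 / 15 * (?f' (y (Suc i)) - ?f' (y i)) + panel_remainder a b (y i) (2*h) k f" if "i < n" for i
    using panel_remainder_2[OF assms(6) k2 _ sub[OF that]]
      panel_remainder_eq_2[OF assms(6) _ sub[OF that] assms(5)] h
    by (simp add: y_Suc power_mult_distrib)
  have "integral {y i..y i + 2*h} (\<lambda>t. Tbar h x k (2*i + 1) t * nderiv_on a b k f t) =
      panel_remainder a b (y i) (2*h) k f" if "i < n" for i
  proof -
    have "Tbar h x k (2*i + 1) t = (-(2*h))^k * panel_kernel (y i) (2*h) (kerP k) (kerQ k) t" for t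
      by (simp add: Tbar_def panel_kernel_def nodes[OF that, simplified] power_minus[of "2*h"])
    then show ?thesis
      by (simp add: panel_remainder_def mult.assoc)
  qed
  then have remainder: "Rbar a b n h x k f = (\<Sum>i<n. panel_remainder a b (y i) (2*h) k f)"
    unfolding Rbar_def sum_odd_eq_sum_lessThan
    by (intro sum.cong) (simp_all add: nodes[simplified])
  have rule: "(\<Sum>j | j \<in> {1..2*n - 1} \<and> odd j.
        7 * f (x (j - 1)) + 16 * f (x j) + 7 * f (x (j + 1))) =
      (\<Sum>i<n. 7 * f (y i) + 16 * f (y i + h) + 7 * f (y i + 2*h))"
    unfolding sum_odd_eq_sum_lessThan by (intro sum.cong) (simp_all add: nodes[simplified])
  have telescope: "(\<Sum>i<n. ?f' (y (Suc i)) - ?f' (y i)) = ?f' b - ?f' a"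
    using sum_lessThan_telescope[of "\<lambda>i. ?f' (y i)" n] by (simp only: y0 yn)
  have "integral {a..b} f =
      (\<Sum>i<n. h / 15 * (7 * f (y i) + 16 * f (y i + h) + 7 * f (y i + 2*h))
        - h^2 / 15 * (?f' (y (Suc i)) - ?f' (y i)) + panel_remainder a b (y i) (2*h) k f)"
    unfolding split by (intro sum.cong) (simp_all only: panel lessThan_iff)
  then show ?thesis
    by (simp only: sum.distrib[of "\<lambda>i. _ i - _ i"] sum_subtractf telescope[unfolded sum_subtractf] rule remainder
        flip: sum_distrib_left)
qed

end
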